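(* Let $p$ be a prime number, let $l\le r$ be integers, let $\beta_l,\ldots,\beta_{r-1}\in\mathbb{Z}_{p^2}$ and let $\lambda_r\in\mathbb{Z}_{p^2}$ with $\gcd(p,\lambda_r)=1$. Let $T_{f[l,r]}:\mathbb{Z}_{p^2}^{\mathbb{Z}}\to\mathbb{Z}_{p^2}^{\mathbb{Z}}$ be the (invertible) one-dimensional linear cellular automaton with local rule $f(x_l,\ldots,x_r)=p\sum_{i=l}^{r-1}\beta_i x_i+\lambda_r x_r\pmod{p^2}$, and let $g$ be the local rule of its inverse, $T_{f[l,r]}^{-1}=T_{g[-(2r-l),-r]}$, which has the form $g(x_{-(2r-l)},\ldots,x_{-r})=-p\sum_{i=-(2r-l)}^{-r}\gamma_i x_i+\lambda_r^{-1}x_{-r}\pmod{p^2}$ with $\gamma_i\in\mathbb{Z}_{p^2}$ and $\lambda_r^{-1}\lambda_r\equiv 1\pmod p$. Then the dynamical system $(\mathbb{Z}_{p^2}^{\mathbb{Z}},\mathcal{B},\mu,T_{f[l,r]})$, where $\mu$ is the uniform Bernoulli measure, is a Bernoulli automorphism.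
   Context: For $m\ge 2$, $\mathbb{Z}_m=\{0,\ldots,m-1\}$ is the ring of integers modulo $m$, and $\mathbb{Z}_m^{\mathbb{Z}}$ is the space of doubly-infinite sequences $x=(x_n)_{n\in\mathbb{Z}}$, with the product topology and Borel $\sigma$-algebra $\mathcal{B}$. For a linear local rule $f(x_l,\ldots,x_r)=\sum_{i=l}^r\lambda_i x_i\pmod m$, the linear cellular automaton $T_{f[l,r]}$ is defined by $(T_{f[l,r]}x)_n=\sum_{i=l}^r\lambda_i x_{n+i}\pmod m$ for all $n\in\mathbb{Z}$. The uniform Bernoulli measure $\mu$ is the Borel probability measure with $\mu(\{x: x_a=j_0,\ldots,x_{a+s}=j_s\})=m^{-(s+1)}$ for all $a\in\mathbb{Z}$, $s\ge 0$, $j_0,\ldots,j_s\in\mathbb{Z}_m$. Partitions $\{C_i\}$ and $\{D_j\}$ of a probability space are $\varepsilon$-independent ($\varepsilon\ge 0$) if $\sum_{i,j}|\mu(C_i\cap D_j)-\mu(C_i)\mu(D_j)|\le\varepsilon$. Let $T$ be an automorphism (invertible, bimeasurable, measure-preserving map) of a probability space. A measurable partition $\xi$ is weakly Bernoulli for $T$ if for every $\varepsilon>0$ there is an integer $N>0$ such that the partitions $\bigvee_{k=-n}^{0}T^k\xi$ and $\bigvee_{k=N}^{N+n}T^k\xi$ are $\varepsilon$-independent for all $n\ge 0$. Here $T^k\xi=\{T^kC: C\in\xi\}$ and $\bigvee$ denotes the common refinement. A partition $\xi$ is a generator for $T$ if the partitions $T^n\xi$, $n\in\mathbb{Z}$,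 together generate the $\sigma$-algebra $\mathcal{B}$ modulo null sets. The automorphism $T$ is Bernoulli if and only if it has a generator which is weakly Bernoulli for $T$.
   Formalization: The hypothesis r ≠ 0 is added: for r = 0 the automaton has finite order (for l = r = 0 and λ_r = 1 it is the identity), so it is never Bernoulli and the claim fails in every such case. *)

theory Defs
  imports "HOL-Probability.Probability" "HOL-Number_Theory.Cong"
begin

section \<open>Configurations over \<open>\<int>/m\<close> and the uniform Bernoulli measure\<close>

text \<open>\<open>\<int>/m\<close> is represented by the residues \<open>{0..<m}\<close>, and arithmetic is followed by \<open>mod m\<close>.\<close>

definition uniform_bernoulli :: "int \<Rightarrow> (int \<Rightarrow> int) measure" where
  "uniform_bernoulli m = PiM UNIV (\<lambda>_. uniform_count_measure {0..<m})"

lemma space_uniform_bernoulli: "space (uniform_bernoulli m) = {x. \<forall>n. x n \<in> {0..<m}}"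
  by (auto simp: uniform_bernoulli_def space_PiM PiE_def Pi_def space_uniform_count_measure)

lemma prob_space_uniform_bernoulli:
  assumes "m > 0"
  shows "prob_space (uniform_bernoulli m)"
  unfolding uniform_bernoulli_def
  using assms by (intro prob_space_PiM prob_space_uniform_count_measure) auto

instance int :: second_countable_topology
proof
  show "\<exists>B::int set set. countable B \<and> open = generate_topology B"
    by (rule exI[of _ "range lessThan \<union> range greaterThan"]) (auto simp: open_int_def)
qed

text \<open>The \<open>\<sigma>\<close>-algebra is the Borel \<open>\<sigma>\<close>-algebra of the product topology.\<close>

lemma sets_uniform_bernoulli:
  "sets (uniform_bernoulli m) = sets (restrict_space borel {x. \<forall>n. x n \<in> {0..<m}})"
proof (rule antisym)
  define \<Omega> :: "(int \<Rightarrow> int) set" where "\<Omega> = {x. \<forall>n. x n \<in> {0..<m}}"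
  let ?N = "restrict_space borel \<Omega> :: (int \<Rightarrow> int) measure"
  have "sets (PiM UNIV (\<lambda>_::int. uniform_count_measure {0..<m})) \<subseteq> sets ?N"
  proof (rule sets_PiM_in_sets)
    show "space ?N = (\<Pi>\<^sub>E i\<in>UNIV. space (uniform_count_measure {0..<m}))"
      by (auto simp: space_restrict_space \<Omega>_def PiE_def Pi_def space_uniform_count_measure)
    fix i :: int and A assume "A \<in> sets (uniform_count_measure {0..<m})"
    have "open A"
      by (rule Topological_Spaces.open_discrete)
    then have "open ((\<lambda>x::int \<Rightarrow> int. x i) -` A)"
      by (intro open_vimage continuous_on_product_coordinates)
    then have "\<Omega> \<inter> (\<lambda>x. x i) -` A \<in> sets ?N"
      unfolding sets_restrict_space by (intro imageI borel_open)
    moreover have "{x \<in> space ?N. x i \<in> A} = \<Omega> \<inter> (\<lambda>x. x i) -` A"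
      by (auto simp: space_restrict_space)
    ultimately show "{x \<in> space ?N. x i \<in> A} \<in> sets ?N"
      by simp
  qed
  then show "sets (uniform_bernoulli m) \<subseteq> sets (restrict_space borel {x. \<forall>n. x n \<in> {0..<m}})"
    by (simp add: uniform_bernoulli_def \<Omega>_def)
next
  let ?\<Omega> = "{x :: int \<Rightarrow> int. \<forall>n. x n \<in> {0..<m}}"
  have "(\<lambda>x. x i) \<in> uniform_bernoulli m \<rightarrow>\<^sub>M (borel :: int measure)" for i
  proof -
    have "(\<lambda>x. x i) \<in> uniform_bernoulli m \<rightarrow>\<^sub>M uniform_count_measure {0..<m}"
      unfolding uniform_bernoulli_def by (rule measurable_component_singleton) simp
    moreover have "(\<lambda>x. x) \<in> uniform_count_measure {0..<m} \<rightarrow>\<^sub>M (borel :: int measure)"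
      by (rule measurableI) (auto simp: space_uniform_count_measure sets_uniform_count_measure)
    ultimately show ?thesis
      by (rule measurable_compose)
  qed
  then have *: "(\<lambda>x. x) \<in> uniform_bernoulli m \<rightarrow>\<^sub>M (borel :: (int \<Rightarrow> int) measure)"
    by (rule measurable_coordinatewise_then_product)
  have "?\<Omega> \<inter> A \<in> sets (uniform_bernoulli m)" if "A \<in> sets borel" for A
    using measurable_sets[OF * that] by (simp add: space_uniform_bernoulli Int_commute)
  then show "sets (restrict_space borel ?\<Omega>) \<subseteq> sets (uniform_bernoulli m)"
    by (auto simp: sets_restrict_space)
qed

lemma measure_uniform_bernoulli_cylinder:
  assumes "m > 0" and "\<And>i. i \<le> s \<Longrightarrow> j i \<in> {0..<m}"
  shows "measure (uniform_bernoulli m)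
      {x \<in> space (uniform_bernoulli m). \<forall>i\<le>s. x (a + int i) = j i} = 1 / of_int m ^ (s + 1)"
proof -
  let ?U = "uniform_count_measure {0..<m}"
  interpret U: prob_space ?U
    using assms(1) by (intro prob_space_uniform_count_measure) auto
  interpret P: product_prob_space "\<lambda>_::int. ?U" UNIV ..
  interpret prob_space "uniform_bernoulli m"
    using assms(1) by (rule prob_space_uniform_bernoulli)
  let ?J = "{a..a + int s}"
  have J: "j (nat (n - a)) \<in> {0..<m}" if "n \<in> ?J" for n
    using that by (intro assms(2)) auto
  have "{x \<in> space (uniform_bernoulli m). \<forall>i\<le>s. x (a + int i) = j i} =
      {x \<in> space (PiM UNIV (\<lambda>_::int. ?U)). \<forall>n\<in>?J. x n \<in> {j (nat (n - a))}}"
  proof -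
    have "(\<forall>i\<le>s. x (a + int i) = j i) \<longleftrightarrow> (\<forall>n\<in>?J. x n = j (nat (n - a)))" for x
    proof (intro iffI ballI allI impI)
      fix n assume "\<forall>i\<le>s. x (a + int i) = j i" "n \<in> ?J"
      then show "x n = j (nat (n - a))"
        by (auto dest!: spec[of _ "nat (n - a)"])
    next
      fix i assume *: "\<forall>n\<in>?J. x n = j (nat (n - a))" and "i \<le> s"
      then show "x (a + int i) = j i"
        using bspec[OF *, of "a + int i"] by auto
    qed
    then show ?thesis
      by (simp add: uniform_bernoulli_def)
  qed
  moreover have "emeasure (PiM UNIV (\<lambda>_::int. ?U))
      {x \<in> space (PiM UNIV (\<lambda>_::int. ?U)). \<forall>n\<in>?J. x n \<in> {j (nat (n - a))}} =
      (\<Prod>n\<in>?J. emeasure ?U {j (nat (n - a))})"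
    using J by (intro P.emeasure_PiM_Collect) (auto simp: sets_uniform_count_measure)
  ultimately have "measure (uniform_bernoulli m)
      {x \<in> space (uniform_bernoulli m). \<forall>i\<le>s. x (a + int i) = j i} =
      enn2real (\<Prod>n\<in>?J. emeasure ?U {j (nat (n - a))})"
    unfolding measure_def by (simp only: uniform_bernoulli_def)
  also have "(\<Prod>n\<in>?J. emeasure ?U {j (nat (n - a))}) = (\<Prod>n\<in>?J. ennreal (1 / of_int m))"
  proof (rule prod.cong[OF refl])
    fix n assume "n \<in> ?J"
    then show "emeasure ?U {j (nat (n - a))} = ennreal (1 / of_int m)"
      using J[of n] assms(1) by (subst emeasure_uniform_count_measure) auto
  qed
  also have "\<dots> = ennreal ((1 / of_int m) ^ (s + 1))"
    using assms(1) by (subst prod_constant) (simp add: ennreal_power nat_add_distrib flip: power_Suc)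
  also have "enn2real \<dots> = 1 / of_int m ^ (s + 1)"
    using assms(1) by (simp add: power_one_over)
  finally show ?thesis .
qed

section \<open>Cellular automata\<close>

text \<open>A local rule is a function of a configuration that reads finitely many coordinates
  \<open>x\<^sub>l, \<dots>, x\<^sub>r\<close>; the automaton applies it to every translate of the configuration.\<close>

definition cellular_automaton :: "((int \<Rightarrow> int) \<Rightarrow> int) \<Rightarrow> (int \<Rightarrow> int) \<Rightarrow> int \<Rightarrow> int" where
  "cellular_automaton f x n = f (\<lambda>i. x (n + i))"

section \<open>Weakly Bernoulli partitions and Bernoulli automorphisms\<close>

definition automorphism :: "'a measure \<Rightarrow> ('a \<Rightarrow> 'a) \<Rightarrow> bool" where
  "automorphism M T \<longleftrightarrow>
     bij_betw T (space M) (space M) \<and>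
     T \<in> M \<rightarrow>\<^sub>M M \<and> inv_into (space M) T \<in> M \<rightarrow>\<^sub>M M \<and>
     distr M M T = M"

definition iterate :: "'a measure \<Rightarrow> ('a \<Rightarrow> 'a) \<Rightarrow> int \<Rightarrow> 'a \<Rightarrow> 'a" where
  "iterate M T k = (if 0 \<le> k then T ^^ nat k else inv_into (space M) T ^^ nat (- k))"

text \<open>Partitions are countable, so that the sum defining \<open>\<epsilon>\<close>-independence carries all the mass.\<close>

definition measurable_partition :: "'a measure \<Rightarrow> 'a set set \<Rightarrow> bool" where
  "measurable_partition M \<xi> \<longleftrightarrow> countable \<xi> \<and> \<xi> \<subseteq> sets M \<and> partition_on (space M) \<xi>"

text \<open>The sum is taken in \<^typ>\<open>ennreal\<close>, where it always exists.\<close>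

definition eps_independent :: "'a measure \<Rightarrow> real \<Rightarrow> 'a set set \<Rightarrow> 'a set set \<Rightarrow> bool" where
  "eps_independent M \<epsilon> P Q \<longleftrightarrow>
     (\<Sum>\<^sub>\<infinity>(C, D)\<in>P \<times> Q. ennreal \<bar>measure M (C \<inter> D) - measure M C * measure M D\<bar>) \<le> ennreal \<epsilon>"

definition image_partition :: "'a measure \<Rightarrow> ('a \<Rightarrow> 'a) \<Rightarrow> 'a set set \<Rightarrow> int \<Rightarrow> 'a set set" where
  "image_partition M T \<xi> k = (\<lambda>C. iterate M T k ` C) ` \<xi>"

definition weakly_bernoulli :: "'a measure \<Rightarrow> ('a \<Rightarrow> 'a) \<Rightarrow> 'a set set \<Rightarrow> bool" where
  "weakly_bernoulli M T \<xi> \<longleftrightarrow>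
     (\<forall>\<epsilon>>0. \<exists>N::int>0. \<forall>n::int\<ge>0.
        eps_independent M \<epsilon>
          (common_refinement (image_partition M T \<xi> ` {-n..0}))
          (common_refinement (image_partition M T \<xi> ` {N..N + n})))"

definition generator :: "'a measure \<Rightarrow> ('a \<Rightarrow> 'a) \<Rightarrow> 'a set set \<Rightarrow> bool" where
  "generator M T \<xi> \<longleftrightarrow>
     (\<forall>A\<in>sets M. \<exists>B\<in>sigma_sets (space M) (\<Union>k. image_partition M T \<xi> k).
        sym_diff A B \<in> null_sets M)"

definition bernoulli_automorphism :: "'a measure \<Rightarrow> ('a \<Rightarrow> 'a) \<Rightarrow> bool" where
  "bernoulli_automorphism M T \<longleftrightarrow>
     prob_space M \<and> automorphism M T \<and>
     (\<exists>\<xi>. measurable_partition M \<xi> \<and> generator M T \<xi> \<and> weakly_bernoulli M T \<xi>)"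

end

theory Submission
  imports Defs
begin

text \<open>Modulo \<open>p\<^sup>2\<close> the automaton is a unit multiple of a power of the shift plus \<open>p\<close> times a linear
  rule. Products of two perturbations vanish, so the \<open>k\<close>-th iterate is again of this form: its value
  at \<open>n\<close> reads only the window \<open>{n + k r - W..n + k r}\<close>, whose width \<open>W = r - l\<close> does not depend
  on \<open>k\<close>. Partition the space by the coordinates in \<open>{0..<\<bar>r\<bar>}\<close>. Past and future of this partition,
  separated by a gap of \<open>W + 2\<close> steps, read disjoint sets of coordinates, so they are independent and
  the partition is weakly Bernoulli. It is a generator because the iterates modulo \<open>p\<close> determine the
  configuration modulo \<open>p\<close>, hence the perturbation, hence the configuration. The measure is
  preserved because its image under a surjective linear map is translation invariant.\<close>

subsection \<open>Cylinder sets and translations\<close>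

text \<open>Closure under changes outside \<open>J\<close> describes cylinder events without naming
  a base, so passing to a larger \<open>J\<close> or to intersections is immediate.\<close>

definition depends_on :: "int \<Rightarrow> int set \<Rightarrow> (int \<Rightarrow> int) set \<Rightarrow> bool" where
  "depends_on m J A \<longleftrightarrow> A \<subseteq> space (uniform_bernoulli m) \<and>
     (\<forall>x\<in>space (uniform_bernoulli m). \<forall>y\<in>space (uniform_bernoulli m).
        (\<forall>j\<in>J. x j = y j) \<longrightarrow> x \<in> A \<longrightarrow> y \<in> A)"

text \<open>Configurations that agree on \<open>J\<close> lie in \<open>A\<close> together, so
  \<open>A\<close> is saturated for restriction to \<open>J\<close>. This makes \<open>A\<close> an
  event of the random variable \<open>restrict x J\<close>, the form in which measurability and
  independence apply.\<close>

lemma depends_on_eq_vimage: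
  assumes "depends_on m J A"
  shows "A = (\<lambda>x. restrict x J) -` ((\<lambda>x. restrict x J) ` A) \<inter> space (uniform_bernoulli m)"
proof (intro equalityI subsetI)
  fix y assume "y \<in> (\<lambda>x. restrict x J) -` ((\<lambda>x. restrict x J) ` A) \<inter> space (uniform_bernoulli m)"
  then obtain x where x: "x \<in> A" "restrict y J = restrict x J" "y \<in> space (uniform_bernoulli m)"
    by auto
  have "x j = y j" if "j \<in> J" for j
    using fun_cong[OF x(2), of j] that by simp
  then show "y \<in> A"
    using assms x unfolding depends_on_def by blast
qed (use assms in \<open>auto simp: depends_on_def\<close>)

lemma depends_on_mono: "depends_on m J A \<Longrightarrow> J \<subseteq> K \<Longrightarrow> depends_on m K A"
  unfolding depends_on_def by blast

text \<open>\<open>I\<close> is nonempty because an empty intersection is \<open>UNIV\<close>, which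
  is not contained in the space of configurations.\<close>

lemma depends_on_INT:
  assumes "I \<noteq> {}" and "\<And>i. i \<in> I \<Longrightarrow> depends_on m J (A i)"
  shows "depends_on m J (\<Inter>i\<in>I. A i)"
  using assms unfolding depends_on_def by blast

lemma sets_PiM_uniform_count_measure:
  assumes "finite J"
  shows "sets (PiM J (\<lambda>_::int. uniform_count_measure {0..<m::int})) = Pow (J \<rightarrow>\<^sub>E {0..<m})"
proof -
  have "sets (PiM J (\<lambda>_. uniform_count_measure {0..<m})) = sets (PiM J (\<lambda>_. count_space {0..<m}))"
    by (intro sets_PiM_cong) (simp_all add: sets_uniform_count_measure_count_space)
  then show ?thesis
    using assms by (simp add: count_space_PiM_finite)
qed

lemma restrict_image_depends_on:
  assumes "finite J" and "depends_on m J A"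
  shows "(\<lambda>x. restrict x J) ` A \<in> sets (PiM J (\<lambda>_. uniform_count_measure {0..<m}))"
  using assms by (auto simp: sets_PiM_uniform_count_measure depends_on_def space_uniform_bernoulli)

text \<open>A finite product of finite discrete spaces is discrete, so over a finite
  \<open>J\<close> every base of a cylinder is measurable.\<close>

lemma sets_depends_on:
  assumes "finite J" and "depends_on m J A"
  shows "A \<in> sets (uniform_bernoulli m)"
proof -
  have "(\<lambda>x. restrict x J) \<in> uniform_bernoulli m \<rightarrow>\<^sub>M PiM J (\<lambda>_. uniform_count_measure {0..<m})"
    unfolding uniform_bernoulli_def by (rule measurable_restrict_subset) simp
  from measurable_sets[OF this restrict_image_depends_on[OF assms]] show ?thesis
    using depends_on_eq_vimage[OF assms(2)] by simp
qed

text \<open>The joint law of the coordinates is the product of their laws, so the coordinates are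
  independent, and hence so are their restrictions to the disjoint sets \<open>J\<close> and
  \<open>K\<close>.\<close>

lemma measure_Int_depends_on:
  assumes "m > 0" and "finite J" "finite K" "J \<inter> K = {}"
    and A: "depends_on m J A" and B: "depends_on m K B"
  shows "measure (uniform_bernoulli m) (A \<inter> B) =
    measure (uniform_bernoulli m) A * measure (uniform_bernoulli m) B"
proof -
  let ?U = "uniform_count_measure {0..<m}"
  let ?M = "uniform_bernoulli m"
  interpret U: prob_space ?U
    using assms(1) by (intro prob_space_uniform_count_measure) auto
  interpret P: product_prob_space "\<lambda>_::int. ?U" UNIV ..
  interpret prob_space ?M
    using assms(1) by (rule prob_space_uniform_bernoulli)
  have rv: "random_variable ?U (\<lambda>x. x i)" for i
    unfolding uniform_bernoulli_def by (rule measurable_component_singleton) simp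
  have "distr ?M ?U (\<lambda>x. x i) = ?U" for i
    unfolding uniform_bernoulli_def by (rule P.PiM_component) simp
  moreover have "distr ?M (PiM UNIV (\<lambda>_. ?U)) (\<lambda>x. \<lambda>i\<in>UNIV. x i) = ?M"
    by (simp add: uniform_bernoulli_def restrict_UNIV)
  ultimately have "indep_vars (\<lambda>_. ?U) (\<lambda>i x. x i) UNIV"
    using rv by (subst indep_vars_iff_distr_eq_PiM') (auto simp: uniform_bernoulli_def)
  from indep_varD[OF indep_var_restrict[OF this \<open>J \<inter> K = {}\<close>]
      restrict_image_depends_on[OF \<open>finite J\<close> A] restrict_image_depends_on[OF \<open>finite K\<close> B]]
  have "prob (((\<lambda>x. restrict x J) -` ((\<lambda>x. restrict x J) ` A) \<inter> space ?M) \<inter>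
      ((\<lambda>x. restrict x K) -` ((\<lambda>x. restrict x K) ` B) \<inter> space ?M)) =
    prob ((\<lambda>x. restrict x J) -` ((\<lambda>x. restrict x J) ` A) \<inter> space ?M) *
    prob ((\<lambda>x. restrict x K) -` ((\<lambda>x. restrict x K) ` B) \<inter> space ?M)"
    by (simp add: vimage_Times comp_def Int_ac)
  then show ?thesis
    using depends_on_eq_vimage[OF A] depends_on_eq_vimage[OF B] by simp
qed

text \<open>Every set of integers is countable, so preimages of single values at single coordinates
  suffice.\<close>

lemma measurable_uniform_bernoulliI:
  assumes "\<And>x. x \<in> space M \<Longrightarrow> f x \<in> space (uniform_bernoulli m)"
    and "\<And>n c. {x \<in> space M. f x n = c} \<in> sets M"
  shows "f \<in> M \<rightarrow>\<^sub>M uniform_bernoulli m"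
  unfolding uniform_bernoulli_def
proof (rule measurable_PiM_single)
  show "f \<in> space M \<rightarrow> (\<Pi>\<^sub>E i\<in>UNIV. space (uniform_count_measure {0..<m}))"
    using assms(1) by (auto simp: space_uniform_bernoulli space_uniform_count_measure)
next
  fix A and n :: int
  have "{x \<in> space M. f x n \<in> A} = (\<Union>c\<in>A. {x \<in> space M. f x n = c})"
    by auto
  also have "\<dots> \<in> sets M"
    using assms(2) by (intro sets.countable_UN') auto
  finally show "{x \<in> space M. f x n \<in> A} \<in> sets M" .
qed

section \<open>Translations and the uniqueness of the invariant measure\<close>

definition translate :: "int \<Rightarrow> (int \<Rightarrow> int) \<Rightarrow> (int \<Rightarrow> int) \<Rightarrow> int \<Rightarrow> int" where
  "translate m z x n = (x n + z n) mod m"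

lemma translate_in_space: "m > 0 \<Longrightarrow> translate m z x \<in> space (uniform_bernoulli m)"
  by (simp add: space_uniform_bernoulli translate_def)

lemma measurable_translate:
  assumes "m > 0"
  shows "translate m z \<in> uniform_bernoulli m \<rightarrow>\<^sub>M uniform_bernoulli m"
proof (rule measurable_uniform_bernoulliI)
  fix n c
  show "{x \<in> space (uniform_bernoulli m). translate m z x n = c} \<in> sets (uniform_bernoulli m)"
    by (rule sets_depends_on[of "{n}"]) (auto simp: depends_on_def translate_def)
qed (use assms translate_in_space in auto)

lemma bij_betw_add_mod:
  assumes "(m::int) > 0"
  shows "bij_betw (\<lambda>a. (a + c) mod m) {0..<m} {0..<m}"
proof (rule bij_betw_byWitness[where f' = "\<lambda>a. (a - c) mod m"])
  show "\<forall>a\<in>{0..<m}. ((a + c) mod m - c) mod m = a"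
    by (auto simp: mod_diff_left_eq)
  show "\<forall>a\<in>{0..<m}. ((a - c) mod m + c) mod m = a"
    by (auto simp: mod_add_left_eq)
qed (use assms in auto)

text \<open>Finite-dimensional boxes determine a product measure. Their mass is expressed by
  cardinalities, so comparing measures becomes counting.\<close>

lemma uniform_bernoulli_eqI:
  assumes "m > 0" and "sets N = sets (uniform_bernoulli m)"
    and "\<And>J X. finite J \<Longrightarrow> (\<And>j. j \<in> J \<Longrightarrow> X j \<subseteq> {0..<m}) \<Longrightarrow>
      emeasure N {x \<in> space (uniform_bernoulli m). \<forall>j\<in>J. x j \<in> X j} =
      ennreal (\<Prod>j\<in>J. card (X j) / of_int m)"
  shows "N = uniform_bernoulli m"
proof -
  let ?U = "uniform_count_measure {0..<m}"
  interpret U: prob_space ?U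
    using assms(1) by (intro prob_space_uniform_count_measure) auto
  interpret P: product_prob_space "\<lambda>_::int. ?U" UNIV ..
  show ?thesis
    unfolding uniform_bernoulli_def
  proof (rule P.PiM_eq)
    show "sets N = sets (PiM UNIV (\<lambda>_. ?U))"
      using assms(2) by (simp add: uniform_bernoulli_def)
    fix J X assume J: "finite J" "\<And>j::int. j \<in> J \<Longrightarrow> X j \<in> sets ?U"
    have eq: "prod_emb UNIV (\<lambda>_. ?U) J (Pi\<^sub>E J X) =
        {x \<in> space (uniform_bernoulli m). \<forall>j\<in>J. x j \<in> X j}"
      by (auto simp: prod_emb_def space_uniform_bernoulli space_uniform_count_measure PiE_iff)
    have "emeasure N {x \<in> space (uniform_bernoulli m). \<forall>j\<in>J. x j \<in> X j} =
        ennreal (\<Prod>j\<in>J. card (X j) / of_int m)"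
      using J by (intro assms(3)) (auto simp: sets_uniform_count_measure)
    also have "\<dots> = (\<Prod>j\<in>J. ennreal (card (X j) / of_int m))"
      using assms(1) by (simp add: prod_ennreal)
    also have "\<dots> = (\<Prod>j\<in>J. emeasure ?U (X j))"
      using J assms(1)
      by (intro prod.cong) (auto simp: emeasure_uniform_count_measure sets_uniform_count_measure)
    finally show "emeasure N (prod_emb UNIV (\<lambda>_. ?U) J (Pi\<^sub>E J X)) = (\<Prod>j\<in>J. emeasure ?U (X j))"
      unfolding eq .
  qed
qed

lemma emeasure_uniform_bernoulli_box:
  assumes "m > 0" "finite J" "\<And>j. j \<in> J \<Longrightarrow> X j \<subseteq> {0..<m}"
  shows "emeasure (uniform_bernoulli m) {x \<in> space (uniform_bernoulli m). \<forall>j\<in>J. x j \<in> X j} =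
      ennreal (\<Prod>j\<in>J. card (X j) / of_int m)"
proof -
  let ?U = "uniform_count_measure {0..<m}"
  interpret U: prob_space ?U
    using assms(1) by (intro prob_space_uniform_count_measure) auto
  interpret P: product_prob_space "\<lambda>_::int. ?U" UNIV ..
  have "emeasure (uniform_bernoulli m) {x \<in> space (uniform_bernoulli m). \<forall>j\<in>J. x j \<in> X j} =
      (\<Prod>j\<in>J. emeasure ?U (X j))"
    unfolding uniform_bernoulli_def using assms
    by (intro P.emeasure_PiM_Collect) (auto simp: sets_uniform_count_measure)
  also have "\<dots> = (\<Prod>j\<in>J. ennreal (card (X j) / of_int m))"
    using assms
    by (intro prod.cong) (auto simp: emeasure_uniform_count_measure sets_uniform_count_measure)
  also have "\<dots> = ennreal (\<Prod>j\<in>J. card (X j) / of_int m)"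
    using assms(1) by (simp add: prod_ennreal)
  finally show ?thesis .
qed

text \<open>Adding \<open>z j\<close> permutes the residues, so the preimage of a box is a box whose
  sides have the same cardinalities.\<close>

lemma distr_translate:
  assumes "m > 0"
  shows "distr (uniform_bernoulli m) (uniform_bernoulli m) (translate m z) = uniform_bernoulli m"
    (is "distr ?M ?M _ = _")
proof (rule uniform_bernoulli_eqI)
  fix J :: "int set" and X assume J: "finite J" "\<And>j. j \<in> J \<Longrightarrow> X j \<subseteq> {0..<m}"
  define Y where "Y j = {a \<in> {0..<m}. (a + z j) mod m \<in> X j}" for j
  have card: "card (Y j) = card (X j)" if "j \<in> J" for j
  proof -
    have b: "bij_betw (\<lambda>a. (a + z j) mod m) {0..<m} {0..<m}"
      using assms by (rule bij_betw_add_mod)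
    have "Y j = {0..<m} \<inter> (\<lambda>a. (a + z j) mod m) -` X j"
      by (auto simp: Y_def)
    then have "(\<lambda>a. (a + z j) mod m) ` Y j = (\<lambda>a. (a + z j) mod m) ` {0..<m} \<inter> X j"
      by blast
    then have "(\<lambda>a. (a + z j) mod m) ` Y j = X j"
      using J(2)[OF that] bij_betw_imp_surj_on[OF b] by blast
    moreover have "inj_on (\<lambda>a. (a + z j) mod m) (Y j)"
      using bij_betw_imp_inj_on[OF b] by (rule inj_on_subset) (auto simp: Y_def)
    ultimately show ?thesis
      using card_image by metis
  qed
  have sets: "{x \<in> space ?M. \<forall>j\<in>J. x j \<in> X j} \<in> sets ?M"
    using J(1) by (rule sets_depends_on) (auto simp: depends_on_def)
  have eq: "translate m z -` {x \<in> space ?M. \<forall>j\<in>J. x j \<in> X j} \<inter> space ?M =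
      {x \<in> space ?M. \<forall>j\<in>J. x j \<in> Y j}"
    using assms translate_in_space[OF assms, of z]
    by (auto simp: Y_def translate_def space_uniform_bernoulli)
  have "emeasure (distr ?M ?M (translate m z)) {x \<in> space ?M. \<forall>j\<in>J. x j \<in> X j} =
      emeasure ?M {x \<in> space ?M. \<forall>j\<in>J. x j \<in> Y j}"
    unfolding emeasure_distr[OF measurable_translate[OF assms] sets] eq ..
  also have "\<dots> = ennreal (\<Prod>j\<in>J. card (Y j) / of_int m)"
    using assms J by (intro emeasure_uniform_bernoulli_box) (auto simp: Y_def)
  also have "\<dots> = ennreal (\<Prod>j\<in>J. card (X j) / of_int m)"
    using card by simp
  finally show "emeasure (distr ?M ?M (translate m z)) {x \<in> space ?M. \<forall>j\<in>J. x j \<in> X j} = \<dots>" .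
qed (use assms in auto)

text \<open>Uniqueness of Haar measure: all cylinders over the same finite window are translates of each other.\<close>

lemma translation_invariant_imp_uniform_bernoulli:
  assumes "m > 0" and "prob_space N" and sets_N: "sets N = sets (uniform_bernoulli m)"
    and inv: "\<And>z. z \<in> space (uniform_bernoulli m) \<Longrightarrow> distr N N (translate m z) = N"
  shows "N = uniform_bernoulli m"
proof (rule uniform_bernoulli_eqI)
  let ?M = "uniform_bernoulli m"
  interpret N: prob_space N by fact
  have space_N: "space N = space ?M"
    using sets_N by (rule sets_eq_imp_space_eq)
  fix J :: "int set" and X assume J: "finite J" "\<And>j. j \<in> J \<Longrightarrow> X j \<subseteq> {0..<m}"
  define cyl where "cyl y = {x \<in> space ?M. \<forall>j\<in>J. x j = y j}" for y
  have sets_cyl: "cyl y \<in> sets N" for y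
    unfolding sets_N using J(1) by (rule sets_depends_on) (auto simp: depends_on_def cyl_def)
  have cyl_eq: "N.prob (cyl y) = N.prob (cyl (\<lambda>_. 0))" if "y \<in> J \<rightarrow>\<^sub>E {0..<m}" for y
  proof -
    \<comment> \<open>Extending \<open>y\<close> by 0 off \<open>J\<close> gives a configuration
      \<open>z\<close>; translation by \<open>z\<close> pulls the cylinder of \<open>y\<close> back
      to the cylinder of the zero word.\<close>
    define z where "z j = (if j \<in> J then y j else 0)" for j
    have z: "z \<in> space ?M"
      using that assms(1) by (auto simp: z_def space_uniform_bernoulli PiE_iff)
    have "translate m z -` cyl y \<inter> space N = cyl (\<lambda>_. 0)"
    proof -
      have "(a + y j) mod m = y j \<longleftrightarrow> a = 0" if "j \<in> J" "a \<in> {0..<m}" for a j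
      proof -
        have yj: "y j \<in> {0..<m}"
          using \<open>y \<in> _\<close> that by auto
        show ?thesis
        proof
          assume "(a + y j) mod m = y j"
          then have "[a + y j = 0 + y j] (mod m)"
            using yj by (simp add: cong_def)
          then have "[a = 0] (mod m)"
            by (simp only: cong_add_rcancel)
          then show "a = 0"
            using that by (simp add: cong_def)
        qed (use yj in auto)
      qed
      then show ?thesis
        using translate_in_space[OF assms(1)]
        by (auto simp: cyl_def space_N translate_def z_def space_uniform_bernoulli)
    qed
    moreover have "translate m z \<in> N \<rightarrow>\<^sub>M N"
      using measurable_translate[OF assms(1), of z] sets_N measurable_cong_sets by blast
    ultimately have "measure (distr N N (translate m z)) (cyl y) = N.prob (cyl (\<lambda>_. 0))"
      using sets_cyl by (simp add: measure_distr)
    then show ?thesis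
      using inv[OF z] by simp
  qed
  \<comment> \<open>A box is the disjoint union of the cylinders of its words, which all have the
    same probability. Applied to the full box, this determines that probability.\<close>
  have box: "N.prob {x \<in> space ?M. \<forall>j\<in>J. x j \<in> Y j} = (\<Prod>j\<in>J. card (Y j)) * N.prob (cyl (\<lambda>_. 0))"
    if Y: "\<And>j. j \<in> J \<Longrightarrow> Y j \<subseteq> {0..<m}" for Y
  proof -
    have sub: "Pi\<^sub>E J Y \<subseteq> J \<rightarrow>\<^sub>E {0..<m}"
      using Y by (intro PiE_mono) auto
    have fin: "finite (Pi\<^sub>E J Y)"
      using finite_subset[OF sub] J(1) by (simp add: finite_PiE)
    have "{x \<in> space ?M. \<forall>j\<in>J. x j \<in> Y j} = (\<Union>y\<in>Pi\<^sub>E J Y. cyl y)"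
    proof (intro equalityI subsetI)
      fix x assume "x \<in> {x \<in> space ?M. \<forall>j\<in>J. x j \<in> Y j}"
      then show "x \<in> (\<Union>y\<in>Pi\<^sub>E J Y. cyl y)"
        by (intro UN_I[of "restrict x J"]) (auto simp: cyl_def)
    qed (auto simp: cyl_def PiE_iff)
    also have "N.prob \<dots> = (\<Sum>y\<in>Pi\<^sub>E J Y. N.prob (cyl y))"
    proof (rule N.finite_measure_finite_Union[OF fin])
      show "disjoint_family_on cyl (Pi\<^sub>E J Y)"
        unfolding disjoint_family_on_def
      proof (intro ballI impI)
        fix y y' assume y: "y \<in> Pi\<^sub>E J Y" "y' \<in> Pi\<^sub>E J Y" "y \<noteq> y'"
        have "\<exists>j\<in>J. y j \<noteq> y' j"
          using PiE_ext[OF y(1,2)] y(3) by blast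
        then show "cyl y \<inter> cyl y' = {}"
          by (auto simp: cyl_def)
      qed
    qed (use sets_cyl in auto)
    also have "\<dots> = (\<Sum>y\<in>Pi\<^sub>E J Y. N.prob (cyl (\<lambda>_. 0)))"
      using sub cyl_eq by (intro sum.cong) auto
    finally show ?thesis
      using J(1) by (simp add: card_PiE)
  qed
  have "{x \<in> space ?M. \<forall>j\<in>J. x j \<in> {0..<m}} = space N"
    by (auto simp: space_N space_uniform_bernoulli)
  then have "of_int m ^ card J * N.prob (cyl (\<lambda>_. 0)) = 1"
    using box[of "\<lambda>_. {0..<m}"] assms(1) N.prob_space by simp
  then have "N.prob (cyl (\<lambda>_. 0)) = 1 / of_int m ^ card J"
    using assms(1) by (simp add: field_simps)
  then show "emeasure N {x \<in> space ?M. \<forall>j\<in>J. x j \<in> X j} = ennreal (\<Prod>j\<in>J. card (X j) / of_int m)"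
    using box[OF J(2)] by (simp add: N.emeasure_eq_measure prod_dividef)
qed (use assms in auto)

subsection \<open>Perturbed shifts\<close>

text \<open>The perturbation is indexed by the distance \<open>i\<close> to the left of the leading
  coordinate \<open>n + s\<close>. The offsets then stay the same when shifts are composed, and
  \<open>W\<close> bounds the window for all iterates.\<close>

definition near_shift :: "int \<Rightarrow> int \<Rightarrow> int \<Rightarrow> (int \<Rightarrow> int) \<Rightarrow> int \<Rightarrow> (int \<Rightarrow> int) \<Rightarrow> int \<Rightarrow> int" where
  "near_shift p W a b s x n = (a * x (n + s) + p * (\<Sum>i=1..W. b i * x (n + s - i))) mod p^2"

lemma near_shift_in_space: "p > 0 \<Longrightarrow> near_shift p W a b s x \<in> space (uniform_bernoulli (p^2))"
  by (simp add: space_uniform_bernoulli near_shift_def)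

lemma near_shift_window:
  assumes "W \<ge> 0" and "\<forall>j\<in>{n+s-W..n+s}. x j = y j"
  shows "near_shift p W a b s x n = near_shift p W a b s y n"
proof -
  have "(\<Sum>i=1..W. b i * x (n + s - i)) = (\<Sum>i=1..W. b i * y (n + s - i))"
    using assms(2) by (intro sum.cong) auto
  then show ?thesis
    using assms by (simp add: near_shift_def)
qed

text \<open>Linearity modulo p^2. In this form it trades a translation of the output for a
  translation of the input, which is what the invariance of the image measure requires.\<close>

lemma near_shift_add:
  "translate (p^2) (near_shift p W a b s w) (near_shift p W a b s x) =
    near_shift p W a b s (translate (p^2) w x)"
proof
  fix n
  let ?m = "p^2"
  have "[translate ?m (near_shift p W a b s w) (near_shift p W a b s x) n =
      (a * x (n + s) + p * (\<Sum>i=1..W. b i * x (n + s - i))) +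
      (a * w (n + s) + p * (\<Sum>i=1..W. b i * w (n + s - i)))] (mod ?m)"
    unfolding cong_def translate_def near_shift_def by (simp add: mod_simps)
  also have "(a * x (n + s) + p * (\<Sum>i=1..W. b i * x (n + s - i))) +
      (a * w (n + s) + p * (\<Sum>i=1..W. b i * w (n + s - i))) =
      a * (x (n + s) + w (n + s)) + p * (\<Sum>i=1..W. b i * (x (n + s - i) + w (n + s - i)))"
    by (simp add: algebra_simps sum.distrib)
  also have "[\<dots> = a * translate ?m w x (n + s) +
      p * (\<Sum>i=1..W. b i * translate ?m w x (n + s - i))] (mod ?m)"
    unfolding translate_def
    by (intro cong_add cong_mult cong_sum cong_refl) (simp_all add: cong_def)
  finally show "translate ?m (near_shift p W a b s w) (near_shift p W a b s x) n =
      near_shift p W a b s (translate ?m w x) n"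
    by (simp add: cong_def near_shift_def translate_def)
qed

text \<open>The products of two perturbation terms carry a factor \<open>p\<^sup>2\<close>, so the window does not grow under composition.\<close>

lemma near_shift_near_shift:
  "near_shift p W a b s (near_shift p W a' b' t x) =
    near_shift p W (a * a') (\<lambda>i. a * b' i + a' * b i) (s + t) x"
proof
  fix n
  let ?y = "near_shift p W a' b' t x"
  define B where "B u = (\<Sum>i=1..W. b' i * x (u - i))" for u
  have y: "[?y u = a' * x (u + t) + p * B (u + t)] (mod p^2)" for u
    by (simp add: near_shift_def B_def cong_def)
  have "[near_shift p W a b s ?y n =
      a * ?y (n + s) + p * (\<Sum>i=1..W. b i * ?y (n + s - i))] (mod p^2)"
    by (simp add: near_shift_def[of p W a] cong_def)
  also have "[a * ?y (n + s) + p * (\<Sum>i=1..W. b i * ?y (n + s - i)) =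
      a * (a' * x (n + s + t) + p * B (n + s + t)) +
      p * (\<Sum>i=1..W. b i * (a' * x (n + s - i + t) + p * B (n + s - i + t)))] (mod p^2)"
    by (intro cong_add cong_mult cong_sum cong_refl y)
  also have "a * (a' * x (n + s + t) + p * B (n + s + t)) +
      p * (\<Sum>i=1..W. b i * (a' * x (n + s - i + t) + p * B (n + s - i + t))) =
      (a * a' * x (n + (s + t)) + p * (\<Sum>i=1..W. (a * b' i + a' * b i) * x (n + (s + t) - i))) +
      p^2 * (\<Sum>i=1..W. b i * B (n + s - i + t))"
    by (simp add: B_def algebra_simps sum.distrib sum_distrib_left power2_eq_square)
  also have "[\<dots> = a * a' * x (n + (s + t)) +
      p * (\<Sum>i=1..W. (a * b' i + a' * b i) * x (n + (s + t) - i))] (mod p^2)"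
    by (simp add: cong_def)
  finally show "near_shift p W a b s ?y n =
      near_shift p W (a * a') (\<lambda>i. a * b' i + a' * b i) (s + t) x n"
    by (simp add: cong_def near_shift_def)
qed

lemma near_shift_id:
  assumes "[a = 1] (mod p^2)" and "\<And>i. i \<in> {1..W} \<Longrightarrow> [b i = 0] (mod p^2)"
    and "x \<in> space (uniform_bernoulli (p^2))"
  shows "near_shift p W a b 0 x = x"
proof
  fix n
  have "[a * x (n + 0) + p * (\<Sum>i=1..W. b i * x (n + 0 - i)) =
      1 * x (n + 0) + p * (\<Sum>i=1..W. 0 * x (n + 0 - i))] (mod p^2)"
    using assms by (intro cong_add cong_mult cong_sum cong_refl) auto
  then show "near_shift p W a b 0 x n = x n"
    using assms(3) by (simp add: cong_def near_shift_def space_uniform_bernoulli)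
qed

text \<open>This is the expansion 1/(a + pB) = 1/a - pB/a^2, exact because p^2 = 0. In either order
  the composite has perturbation \<open>a' * b i * (1 - a' * a)\<close>, which vanishes, and shift
  0.\<close>

lemma near_shift_inverse:
  assumes inv: "[a' * a = 1] (mod p^2)" and x: "x \<in> space (uniform_bernoulli (p^2))"
  shows "near_shift p W a' (\<lambda>i. - (a'^2 * b i)) (- s) (near_shift p W a b s x) = x"
    and "near_shift p W a b s (near_shift p W a' (\<lambda>i. - (a'^2 * b i)) (- s) x) = x"
proof -
  have "[a' * b i + a * - (a'^2 * b i) = 0] (mod p^2)" for i
  proof -
    have "a' * b i + a * - (a'^2 * b i) = a' * b i * (1 - a' * a)"
      by (simp add: algebra_simps power2_eq_square)
    also have "[\<dots> = a' * b i * (1 - 1)] (mod p^2)"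
      by (intro cong_mult cong_diff cong_refl inv)
    finally show ?thesis by simp
  qed
  then show "near_shift p W a' (\<lambda>i. - (a'^2 * b i)) (- s) (near_shift p W a b s x) = x"
    and "near_shift p W a b s (near_shift p W a' (\<lambda>i. - (a'^2 * b i)) (- s) x) = x"
    using inv x by (auto simp: near_shift_near_shift mult.commute[of a a'] add.commute intro!: near_shift_id)
qed

lemma ex_inverse_mod_square:
  assumes "coprime a (p::int)"
  obtains a' where "[a' * a = 1] (mod p^2)"
  using assms cong_solve_coprime_int[of a "p^2"] by (auto simp: mult.commute)

lemma coprime_inverse_mod_square:
  assumes "[a' * a = (1::int)] (mod p^2)"
  shows "coprime a' p" "coprime a p"
proof -
  have "coprime (a' * a) (p^2)"
    using assms by (metis cong_imp_coprime cong_sym coprime_1_left)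
  then show "coprime a' p" "coprime a p"
    by auto
qed

text \<open>Only the shift \<open>int n * s\<close> and the invertibility of the leading coefficient
  matter later, so \<open>c\<close> and \<open>d\<close> stay existential. The claim is confined to
  the space because for \<open>n = 0\<close> the right-hand side reduces its argument modulo
  p^2.\<close>

lemma funpow_near_shift:
  assumes "coprime a p"
  shows "\<exists>c d. coprime c p \<and> (\<forall>x\<in>space (uniform_bernoulli (p^2)).
    (near_shift p W a b s ^^ n) x = near_shift p W c d (int n * s) x)"
proof (induction n)
  case 0
  show ?case
    by (intro exI[of _ 1] exI[of _ "\<lambda>_. 0"]) (simp add: near_shift_id)
next
  case (Suc n)
  then obtain c d where "coprime c p"
    "\<forall>x\<in>space (uniform_bernoulli (p^2)).
      (near_shift p W a b s ^^ n) x = near_shift p W c d (int n * s) x"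
    by auto
  with assms show ?case
    by (intro exI[of _ "a * c"] exI[of _ "\<lambda>i. a * d i + c * b i"])
      (simp add: near_shift_near_shift algebra_simps)
qed

section \<open>Iterates with integer exponents\<close>

lemma funpow_left_inverse:
  assumes "\<And>x. x \<in> S \<Longrightarrow> f x \<in> S" and "\<And>x. x \<in> S \<Longrightarrow> g (f x) = x" and "x \<in> S"
  shows "(g ^^ n) ((f ^^ n) x) = x"
  using \<open>x \<in> S\<close>
proof (induction n arbitrary: x)
  case (Suc n)
  have "(g ^^ Suc n) ((f ^^ Suc n) x) = g ((g ^^ n) ((f ^^ n) (f x)))"
    by (simp add: funpow_swap1)
  also have "\<dots> = x"
    using Suc assms by simp
  finally show ?case .
qed simp

lemma funpow_in:
  assumes "\<And>x. x \<in> S \<Longrightarrow> f x \<in> S" and "x \<in> S"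
  shows "(f ^^ n) x \<in> S"
  using assms by (induction n) auto

lemma funpow_cong_on:
  assumes "\<And>x. x \<in> S \<Longrightarrow> f x \<in> S" and "\<And>x. x \<in> S \<Longrightarrow> g x = f x" and "x \<in> S"
  shows "(g ^^ n) x = (f ^^ n) x"
  using assms by (induction n) (auto simp: funpow_in)

lemma iterate_in_space:
  assumes "bij_betw T (space M) (space M)" and "x \<in> space M"
  shows "iterate M T k x \<in> space M"
  using assms bij_betw_apply[OF assms(1)] bij_betw_apply[OF bij_betw_inv_into[OF assms(1)]]
  by (auto simp: iterate_def intro: funpow_in)

lemma iterate_minus_iterate:
  assumes "bij_betw T (space M) (space M)" and "x \<in> space M"
  shows "iterate M T (- k) (iterate M T k x) = x"
  using assms bij_betw_apply[OF assms(1)] bij_betw_apply[OF bij_betw_inv_into[OF assms(1)]]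
  by (auto simp: iterate_def bij_betw_inv_into_left bij_betw_inv_into_right
      intro!: funpow_left_inverse[where S = "space M"])

text \<open>Cells of the shifted partitions are images; bijectivity rewrites them as preimages,
  where membership becomes a condition on coordinates.\<close>

lemma iterate_image:
  assumes T: "bij_betw T (space M) (space M)" and "C \<subseteq> space M"
  shows "iterate M T k ` C = {x \<in> space M. iterate M T (- k) x \<in> C}"
proof (intro equalityI subsetI)
  fix x assume "x \<in> {x \<in> space M. iterate M T (- k) x \<in> C}"
  then show "x \<in> iterate M T k ` C"
    using iterate_minus_iterate[OF T, of x "- k"] by (intro image_eqI[of _ _ "iterate M T (- k) x"]) auto
qed (use assms in \<open>auto simp: iterate_minus_iterate iterate_in_space subset_iff\<close>)

section \<open>Perturbed shifts are automorphisms\<close>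

lemma measurable_near_shift:
  assumes "p > 0" and "W \<ge> 0"
  shows "near_shift p W a b s \<in> uniform_bernoulli (p^2) \<rightarrow>\<^sub>M uniform_bernoulli (p^2)"
proof (rule measurable_uniform_bernoulliI)
  fix n c
  show "{x \<in> space (uniform_bernoulli (p^2)). near_shift p W a b s x n = c} \<in> sets (uniform_bernoulli (p^2))"
    using near_shift_window[OF \<open>W \<ge> 0\<close>, of n s _ _ p a b]
    by (intro sets_depends_on[of "{n + s - W..n + s}"]) (auto simp: depends_on_def)
qed (use assms near_shift_in_space in auto)

lemma near_shift_bij:
  assumes "p > 0" and "[a' * a = 1] (mod p^2)"
  shows "bij_betw (near_shift p W a b s) (space (uniform_bernoulli (p^2))) (space (uniform_bernoulli (p^2)))"
  by (rule bij_betw_byWitness[where f' = "near_shift p W a' (\<lambda>i. - (a'^2 * b i)) (- s)"])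
    (use assms in \<open>auto simp: near_shift_inverse near_shift_in_space\<close>)

lemma inv_into_near_shift:
  assumes "p > 0" and "[a' * a = 1] (mod p^2)" and "x \<in> space (uniform_bernoulli (p^2))"
  shows "inv_into (space (uniform_bernoulli (p^2))) (near_shift p W a b s) x =
    near_shift p W a' (\<lambda>i. - (a'^2 * b i)) (- s) x"
  using assms by (intro inv_into_f_eq bij_betw_imp_inj_on[OF near_shift_bij])
    (auto simp: near_shift_inverse near_shift_in_space)

text \<open>Surjectivity gives \<open>z\<close> a preimage \<open>w\<close>, and by linearity
  translating the output by \<open>z\<close> equals translating the input by \<open>w\<close>. As
  the input measure is translation invariant, so is its image, which is therefore the uniform
  measure.\<close>

lemma distr_near_shift:
  assumes "p > 0" and "W \<ge> 0" and "[a' * a = 1] (mod p^2)"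
  shows "distr (uniform_bernoulli (p^2)) (uniform_bernoulli (p^2)) (near_shift p W a b s) =
    uniform_bernoulli (p^2)"
    (is "distr ?M ?M ?T = ?M")
proof (rule translation_invariant_imp_uniform_bernoulli)
  have m: "p^2 > 0"
    using assms by simp
  interpret prob_space ?M
    using m by (rule prob_space_uniform_bernoulli)
  have T: "?T \<in> ?M \<rightarrow>\<^sub>M ?M"
    using assms(1,2) by (rule measurable_near_shift)
  show "prob_space (distr ?M ?M ?T)"
    using T by (rule prob_space_distr)
  fix z assume z: "z \<in> space ?M"
  define w where "w = near_shift p W a' (\<lambda>i. - (a'^2 * b i)) (- s) z"
  have "?T w = z"
    unfolding w_def using assms(3) z by (rule near_shift_inverse)
  then have eq: "translate (p^2) z \<circ> ?T = ?T \<circ> translate (p^2) w"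
    using near_shift_add[of p W a b s w] by (auto simp del: fun_upd_apply)
  \<comment> \<open>The target argument of \<open>distr\<close> counts only through its sets, so it
    can be replaced by \<open>?M\<close>.\<close>
  have "distr (distr ?M ?M ?T) (distr ?M ?M ?T) (translate (p^2) z) =
      distr (distr ?M ?M ?T) ?M (translate (p^2) z)"
    by (rule distr_cong) auto
  also have "\<dots> = distr (distr ?M ?M (translate (p^2) w)) ?M ?T"
    using T measurable_translate[OF m] by (simp add: distr_distr eq)
  finally show "distr (distr ?M ?M ?T) (distr ?M ?M ?T) (translate (p^2) z) = distr ?M ?M ?T"
    by (simp add: distr_translate[OF m])
qed (use assms in auto)

lemma automorphism_near_shift:
  assumes "p > 0" and "W \<ge> 0" and "[a' * a = 1] (mod p^2)"
  shows "automorphism (uniform_bernoulli (p^2)) (near_shift p W a b s)"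
  unfolding automorphism_def
proof (intro conjI)
  show "inv_into (space (uniform_bernoulli (p^2))) (near_shift p W a b s)
      \<in> uniform_bernoulli (p^2) \<rightarrow>\<^sub>M uniform_bernoulli (p^2)"
    by (subst measurable_cong[OF inv_into_near_shift[OF assms(1,3)]])
      (use assms measurable_near_shift in auto)
qed (use assms near_shift_bij measurable_near_shift distr_near_shift in auto)

text \<open>On the space the inverse is again a perturbed shift, with the same \<open>W\<close> and
  shift \<open>- s\<close>, so powers of either sign have the same form.\<close>

lemma iterate_near_shift:
  assumes "p > 0" and inv: "[a' * a = 1] (mod p^2)"
  shows "\<exists>c d. coprime c p \<and> (\<forall>x\<in>space (uniform_bernoulli (p^2)).
    iterate (uniform_bernoulli (p^2)) (near_shift p W a b s) k x = near_shift p W c d (k * s) x)"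
proof (cases "0 \<le> k")
  case True
  then show ?thesis
    using funpow_near_shift[OF coprime_inverse_mod_square(2)[OF inv], where n = "nat k" and W = W and b = b and s = s]
    by (simp add: iterate_def)
next
  case False
  let ?M = "uniform_bernoulli (p^2)"
  let ?G = "near_shift p W a' (\<lambda>i. - (a'^2 * b i)) (- s)"
  have "iterate ?M (near_shift p W a b s) k x = (?G ^^ nat (- k)) x" if "x \<in> space ?M" for x
    unfolding iterate_def using False that assms
    by (simp, intro funpow_cong_on[of "space ?M"])
      (auto simp: near_shift_in_space inv_into_near_shift)
  then show ?thesis
    using funpow_near_shift[OF coprime_inverse_mod_square(1)[OF inv], where n = "nat (- k)" and W = W and s = "- s"
        and b = "\<lambda>i. - (a'^2 * b i)"] False
    by simp
qed

subsection \<open>The window partition\<close>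

text \<open>Indexing the cells by configurations keeps each cell nonempty, as
  \<open>partition_on\<close> demands. The width used later is the absolute value of
  \<open>r\<close>, so that translates of the window by multiples of \<open>r\<close> tile the
  integers.\<close>

definition window_partition :: "int \<Rightarrow> int \<Rightarrow> (int \<Rightarrow> int) set set" where
  "window_partition m w = (\<lambda>x. {y \<in> space (uniform_bernoulli m). \<forall>i\<in>{0..<w}. y i = x i}) `
     space (uniform_bernoulli m)"

lemma countable_window_partition: "countable (window_partition m w)"
proof -
  let ?h = "\<lambda>c. {y \<in> space (uniform_bernoulli m). \<forall>i\<in>{0..<w}. y i = c i}"
  have "window_partition m w \<subseteq> ?h ` ({0..<w} \<rightarrow>\<^sub>E {0..<m})"
    unfolding window_partition_def
  proof (intro image_subsetI)
    fix x assume "x \<in> space (uniform_bernoulli m)"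
    then show "?h x \<in> ?h ` ({0..<w} \<rightarrow>\<^sub>E {0..<m})"
      by (intro image_eqI[of _ _ "restrict x {0..<w}"]) (auto simp: space_uniform_bernoulli)
  qed
  then show ?thesis
    by (rule countable_subset) (intro countable_finite finite_imageI finite_PiE, auto)
qed

lemma measurable_partition_window_partition:
  "measurable_partition (uniform_bernoulli m) (window_partition m w)"
  unfolding measurable_partition_def
proof (intro conjI countable_window_partition)
  show "window_partition m w \<subseteq> sets (uniform_bernoulli m)"
    unfolding window_partition_def
    by (intro image_subsetI sets_depends_on[of "{0..<w}"]) (auto simp: depends_on_def)
  show "partition_on (space (uniform_bernoulli m)) (window_partition m w)"
  proof (rule partition_onI)
    fix P Q assume "P \<in> window_partition m w" "Q \<in> window_partition m w" "P \<noteq> Q"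
    then obtain x y where
      P: "P = {z \<in> space (uniform_bernoulli m). \<forall>i\<in>{0..<w}. z i = x i}" and
      Q: "Q = {z \<in> space (uniform_bernoulli m). \<forall>i\<in>{0..<w}. z i = y i}"
      by (auto simp: window_partition_def)
    show "disjnt P Q"
    proof (rule ccontr)
      assume "\<not> disjnt P Q"
      then obtain z where "z \<in> P" "z \<in> Q"
        by (auto simp: disjnt_def)
      then have "\<forall>i\<in>{0..<w}. x i = y i"
        by (simp add: P Q)
      then show False
        using \<open>P \<noteq> Q\<close> by (simp add: P Q)
    qed
  qed (auto simp: window_partition_def)
qed

text \<open>The second function takes countably many values and may be held constant on each of its
  level sets.\<close>

lemma measurable_int_diff:
  fixes f g :: "'a \<Rightarrow> int"
  assumes "f \<in> M \<rightarrow>\<^sub>M count_space UNIV" and "g \<in> M \<rightarrow>\<^sub>M count_space UNIV"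
  shows "(\<lambda>x. f x - g x) \<in> M \<rightarrow>\<^sub>M count_space UNIV"
  using measurable_compose_countable[of "\<lambda>i x. f x - i", OF _ assms(2)]
    measurable_compose[OF assms(1), of "\<lambda>j. j - _"] by simp

lemma measurable_int_add:
  fixes f g :: "'a \<Rightarrow> int"
  assumes "f \<in> M \<rightarrow>\<^sub>M count_space UNIV" and "g \<in> M \<rightarrow>\<^sub>M count_space UNIV"
  shows "(\<lambda>x. f x + g x) \<in> M \<rightarrow>\<^sub>M count_space UNIV"
  using measurable_compose_countable[of "\<lambda>i x. f x + i", OF _ assms(2)]
    measurable_compose[OF assms(1), of "\<lambda>j. j + _"] by simp

lemma measurable_int_sum:
  fixes f :: "'i \<Rightarrow> 'a \<Rightarrow> int"
  assumes "\<And>i. i \<in> I \<Longrightarrow> f i \<in> M \<rightarrow>\<^sub>M count_space UNIV"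
  shows "(\<lambda>x. \<Sum>i\<in>I. f i x) \<in> M \<rightarrow>\<^sub>M count_space UNIV"
  using assms by (induction I rule: infinite_finite_induct) (auto intro: measurable_int_add)

section \<open>Independence of past and future\<close>

text \<open>A cell of the \<open>k\<close>-th image constrains the iterate of exponent
  \<open>- k\<close> on \<open>{0..<w}\<close>. That iterate shifts by \<open>- k * s\<close> and
  reads \<open>W\<close> further coordinates to the left.\<close>

lemma depends_on_image_window_partition:
  assumes "p > 0" and "W \<ge> 0" and "[a' * a = 1] (mod p^2)"
    and D: "D \<in> image_partition (uniform_bernoulli (p^2)) (near_shift p W a b s)
      (window_partition (p^2) w) k"
  shows "depends_on (p^2) {- k * s - W..- k * s + w - 1} D"
proof -
  let ?M = "uniform_bernoulli (p^2)"
  let ?T = "near_shift p W a b s"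
  obtain c d where cd: "\<And>x. x \<in> space ?M \<Longrightarrow> iterate ?M ?T (- k) x = near_shift p W c d (- k * s) x"
    using iterate_near_shift[OF assms(1,3)] by blast
  obtain C where C: "C \<in> window_partition (p^2) w" "D = iterate ?M ?T k ` C"
    using D by (auto simp: image_partition_def)
  then obtain z where z: "C = {y \<in> space ?M. \<forall>i\<in>{0..<w}. y i = z i}"
    by (auto simp: window_partition_def)
  have "D = {x \<in> space ?M. iterate ?M ?T (- k) x \<in> C}"
    unfolding C(2) by (rule iterate_image[OF near_shift_bij]) (use assms z in auto)
  then have D_eq: "D = {x \<in> space ?M. \<forall>i\<in>{0..<w}. near_shift p W c d (- k * s) x i = z i}"
    using assms(1) by (auto simp: z cd near_shift_in_space)
  have *: "near_shift p W c d (- k * s) x i = near_shift p W c d (- k * s) y i"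
    if "\<forall>j\<in>{- k * s - W..- k * s + w - 1}. x j = y j" "i \<in> {0..<w}" for x y i
    using assms(2) by (rule near_shift_window) (use that in auto)
  show ?thesis
    unfolding depends_on_def
  proof (intro conjI ballI impI)
    fix x y
    assume xy: "\<forall>j\<in>{- k * s - W..- k * s + w - 1}. x j = y j"
      and "x \<in> D" "y \<in> space ?M"
    then show "y \<in> D"
      unfolding D_eq using *[OF xy] by simp
  qed (simp add: D_eq)
qed

lemma depends_on_common_refinement:
  assumes "K \<noteq> {}" and "\<And>k D. k \<in> K \<Longrightarrow> D \<in> P k \<Longrightarrow> depends_on m (J k) D"
    and "D \<in> common_refinement (P ` K)"
  shows "depends_on m (\<Union>k\<in>K. J k) D"
proof -
  obtain f where f: "D = (\<Inter>Q\<in>P ` K. f Q)" "\<And>Q. Q \<in> P ` K \<Longrightarrow> f Q \<in> Q"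
    using assms(3) by (auto simp: common_refinement Pi_iff)
  show ?thesis
    unfolding f(1)
  proof (rule depends_on_INT)
    fix Q assume "Q \<in> P ` K"
    \<comment> \<open>Different exponents may give the same partition; any \<open>k\<close> that
      yields \<open>Q\<close> serves.\<close>
    then obtain k where "k \<in> K" "Q = P k"
      by auto
    then show "depends_on m (\<Union>k\<in>K. J k) (f Q)"
      using assms(2)[of k "f Q"] f(2) by (auto intro: depends_on_mono)
  qed (use assms(1) in auto)
qed

text \<open>Both windows have length \<open>W + \<bar>r\<bar>\<close>, and their left ends are at
  least \<open>(W + 2) * \<bar>r\<bar>\<close> apart, which is no less. The sign of \<open>r\<close>
  decides which window lies to the left.\<close>

lemma separated_windows:
  fixes r W k k' :: int
  assumes "r \<noteq> 0" "W \<ge> 0" "k \<le> 0" "W + 2 \<le> k'"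
  shows "{- k * r - W..- k * r + \<bar>r\<bar> - 1} \<inter> {- k' * r - W..- k' * r + \<bar>r\<bar> - 1} = {}"
proof -
  have "(W + 2) * \<bar>r\<bar> \<le> (k' - k) * \<bar>r\<bar>"
    using assms by (intro mult_right_mono) auto
  moreover have "(W + 1) * 1 \<le> (W + 1) * \<bar>r\<bar>"
    using assms by (intro mult_left_mono) auto
  ultimately have "W + \<bar>r\<bar> \<le> \<bar>(- k * r) - (- k' * r)\<bar>"
    using assms by (auto simp: algebra_simps abs_mult abs_if split: if_splits)
  then show ?thesis
    by (auto simp: abs_if split: if_splits)
qed

lemma weakly_bernoulli_near_shift:
  assumes "p > 0" and "W \<ge> 0" and inv: "[a' * a = 1] (mod p^2)" and "r \<noteq> 0"
  shows "weakly_bernoulli (uniform_bernoulli (p^2)) (near_shift p W a b r) (window_partition (p^2) \<bar>r\<bar>)"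
    (is "weakly_bernoulli ?M ?T ?\<xi>")
  unfolding weakly_bernoulli_def
proof (intro allI impI)
  fix \<epsilon> :: real assume "\<epsilon> > 0"
  \<comment> \<open>The gap depends on neither \<open>\<epsilon>\<close> nor \<open>n\<close>: every
    term of the sum in \<open>eps_independent\<close> is exactly 0.\<close>
  define N where "N = W + 2"
  define J where "J k = {- k * r - W..- k * r + \<bar>r\<bar> - 1}" for k
  have "eps_independent ?M \<epsilon> (common_refinement (image_partition ?M ?T ?\<xi> ` {- n..0}))
      (common_refinement (image_partition ?M ?T ?\<xi> ` {N..N + n}))" if "n \<ge> 0" for n
  proof -
    have "measure ?M (C \<inter> D) = measure ?M C * measure ?M D"
      if C: "C \<in> common_refinement (image_partition ?M ?T ?\<xi> ` {- n..0})"
        and D: "D \<in> common_refinement (image_partition ?M ?T ?\<xi> ` {N..N + n})" for C D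
    proof (rule measure_Int_depends_on)
      show "depends_on (p^2) (\<Union>k\<in>{- n..0}. J k) C"
        using _ _ C unfolding J_def
        by (rule depends_on_common_refinement)
          (use \<open>n \<ge> 0\<close> depends_on_image_window_partition[OF assms(1-3)] in auto)
      show "depends_on (p^2) (\<Union>k\<in>{N..N + n}. J k) D"
        using _ _ D unfolding J_def
        by (rule depends_on_common_refinement)
          (use \<open>n \<ge> 0\<close> depends_on_image_window_partition[OF assms(1-3)] in auto)
      show "(\<Union>k\<in>{- n..0}. J k) \<inter> (\<Union>k\<in>{N..N + n}. J k) = {}"
      proof -
        have "J k \<inter> J k' = {}" if "k \<in> {- n..0}" "k' \<in> {N..N + n}" for k k'
          unfolding J_def using assms(4,2) by (rule separated_windows) (use that in \<open>auto simp: N_def\<close>)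
        then show ?thesis
          by blast
      qed
    qed (use assms(1) in \<open>auto simp: J_def\<close>)
    then show ?thesis
      unfolding eps_independent_def by (subst infsum_0) auto
  qed
  moreover have "N > 0"
    using assms(2) by (simp add: N_def)
  ultimately show "\<exists>N>0. \<forall>n\<ge>0. eps_independent ?M \<epsilon>
      (common_refinement (image_partition ?M ?T ?\<xi> ` {- n..0}))
      (common_refinement (image_partition ?M ?T ?\<xi> ` {N..N + n}))"
    by blast
qed

text \<open>The \<open>k\<close>-th iterate determines \<open>p x\<^sub>j\<close> modulo \<open>p\<^sup>2\<close> for the coordinates \<open>j\<close> in \<open>{k r..<k r + \<bar>r\<bar>}\<close>;
  since \<open>p x\<close> is all that the perturbation sees, this then determines \<open>x\<^sub>j\<close> itself.\<close>

lemma generator_near_shift: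
  assumes "p > 0" and "W \<ge> 0" and inv: "[a' * a = 1] (mod p^2)" and "r \<noteq> 0"
  shows "generator (uniform_bernoulli (p^2)) (near_shift p W a b r) (window_partition (p^2) \<bar>r\<bar>)"
    (is "generator ?M ?T ?\<xi>")
proof -
  define \<G> where "\<G> = (\<Union>k. image_partition ?M ?T ?\<xi> k)"
  \<comment> \<open>The aim is that all coordinates are \<open>S\<close>-measurable. Then the
    identity is measurable from \<open>S\<close> to \<open>?M\<close>, and every measurable set lies
    in the generated sigma-algebra itself, not only modulo null sets.\<close>
  define S where "S = sigma (space ?M) \<G>"
  have bij: "bij_betw ?T (space ?M) (space ?M)"
    using assms(1) inv by (rule near_shift_bij)
  have D_space: "D \<subseteq> space ?M" if "D \<in> image_partition ?M ?T ?\<xi> k" for D k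
    using depends_on_image_window_partition[OF assms(1-3) that] by (simp add: depends_on_def)
  then have "\<G> \<subseteq> Pow (space ?M)"
    by (auto simp: \<G>_def)
  then have sets_S: "sets S = sigma_sets (space ?M) \<G>" and space_S: "space S = space ?M"
    by (simp_all add: S_def)
  have iter: "(\<lambda>x. iterate ?M ?T k x n) \<in> S \<rightarrow>\<^sub>M count_space UNIV" if n: "n \<in> {0..<\<bar>r\<bar>}" for k n
  proof (subst measurable_count_space_eq2_countable, intro conjI ballI)
    fix c
    let ?A = "(\<lambda>x. iterate ?M ?T k x n) -` {c} \<inter> space S"
    \<comment> \<open>Cells with exponent \<open>- k\<close> are preimages under the iterate of
      exponent \<open>k\<close>. Since \<open>n\<close> lies in the window, each of them fixes the
      value at \<open>n\<close>, so the event is the countable union of the cells it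
      contains.\<close>
    let ?Ds = "{D \<in> image_partition ?M ?T ?\<xi> (- k). D \<subseteq> ?A}"
    have "?A \<subseteq> \<Union> ?Ds"
    proof
      fix x assume x: "x \<in> ?A"
      define C where "C = {y \<in> space ?M. \<forall>i\<in>{0..<\<bar>r\<bar>}. y i = iterate ?M ?T k x i}"
      have k_x: "iterate ?M ?T k x \<in> space ?M"
        using bij x by (auto simp: space_S intro: iterate_in_space)
      then have "C \<in> ?\<xi>"
        by (auto simp: C_def window_partition_def)
      then have D_in: "iterate ?M ?T (- k) ` C \<in> image_partition ?M ?T ?\<xi> (- k)"
        unfolding image_partition_def by (rule imageI)
      have D: "iterate ?M ?T (- k) ` C = {y \<in> space ?M. iterate ?M ?T k y \<in> C}"
        by (subst iterate_image[OF bij]) (auto simp: C_def)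
      have "iterate ?M ?T (- k) ` C \<subseteq> ?A"
        unfolding D using x n by (auto simp: C_def space_S)
      moreover have "x \<in> iterate ?M ?T (- k) ` C"
        unfolding D using x k_x by (auto simp: C_def space_S)
      ultimately show "x \<in> \<Union> ?Ds"
        using D_in by (intro UnionI[of "iterate ?M ?T (- k) ` C"] CollectI conjI)
    qed
    then have "?A = \<Union> ?Ds"
      by blast
    also have "\<dots> \<in> sets S"
    proof (rule sets.countable_Union)
      show "countable ?Ds"
        by (rule countable_subset[of _ "image_partition ?M ?T ?\<xi> (- k)"])
          (auto simp: image_partition_def countable_window_partition)
      show "?Ds \<subseteq> sets S"
        by (auto simp: sets_S \<G>_def)
    qed
    finally show "?A \<in> sets S" .
  qed auto
  have rep: "\<exists>k n c c' d. n \<in> {0..<\<bar>r\<bar>} \<and> [c' * c = 1] (mod p^2) \<and>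
      (\<forall>x\<in>space ?M. iterate ?M ?T k x n = (c * x j + p * (\<Sum>i=1..W. d i * x (j - i))) mod p^2)" for j
  proof -
    \<comment> \<open>Division of \<open>j\<close> by the absolute value of \<open>r\<close>; the
      factor \<open>sgn r\<close> gives \<open>k\<close> the sign that makes
      \<open>n + k * r = j\<close> for negative \<open>r\<close> as well.\<close>
    define k n where "k = sgn r * (j div \<bar>r\<bar>)" and "n = j mod \<bar>r\<bar>"
    have "k * r = j div \<bar>r\<bar> * \<bar>r\<bar>"
      by (simp add: k_def abs_sgn mult_ac)
    then have j: "n + k * r = j"
      by (simp add: n_def)
    obtain c d where "coprime c p"
      and it: "\<forall>x\<in>space ?M. iterate ?M ?T k x = near_shift p W c d (k * r) x"
      using iterate_near_shift[OF assms(1) inv] by blast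
    obtain c' where "[c' * c = 1] (mod p^2)"
      using ex_inverse_mod_square[OF \<open>coprime c p\<close>] by blast
    moreover have "n \<in> {0..<\<bar>r\<bar>}"
      using assms(4) by (simp add: n_def)
    ultimately show ?thesis
      using it j
      by (intro exI[of _ k] exI[of _ n] exI[of _ c] exI[of _ c'] exI[of _ d]) (simp add: near_shift_def)
  qed
  have p_coord: "(\<lambda>x. (p * x j) mod p^2) \<in> S \<rightarrow>\<^sub>M count_space UNIV" for j
  proof -
    obtain k n c c' d where n: "n \<in> {0..<\<bar>r\<bar>}" and c': "[c' * c = 1] (mod p^2)"
      and it: "\<And>x. x \<in> space ?M \<Longrightarrow>
        iterate ?M ?T k x n = (c * x j + p * (\<Sum>i=1..W. d i * x (j - i))) mod p^2"
      using rep[of j] by blast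
    \<comment> \<open>Multiplication by \<open>p\<close> kills the perturbation, and
      \<open>c'\<close> cancels the leading coefficient.\<close>
    have "(p * x j) mod p^2 = (p * c' * iterate ?M ?T k x n) mod p^2"
      if "x \<in> space S" for x
    proof -
      let ?s = "\<Sum>i=1..W. d i * x (j - i)"
      have "[p * c' * iterate ?M ?T k x n = p * c' * (c * x j + p * ?s)] (mod p^2)"
        using that by (intro cong_mult cong_refl) (simp add: it space_S cong_def)
      also have "p * c' * (c * x j + p * ?s) = p * x j * (c' * c) + p^2 * (c' * ?s)"
        by (simp add: algebra_simps power2_eq_square)
      also have "[\<dots> = p * x j * 1 + 0] (mod p^2)"
        by (intro cong_add cong_mult cong_refl c') (simp add: cong_def)
      finally show ?thesis
        by (simp add: cong_def)
    qed
    then show ?thesis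
      using measurable_compose[OF iter[OF n], of "\<lambda>v. (p * c' * v) mod p^2" "count_space UNIV"]
      by (subst measurable_cong) auto
  qed
  have coord: "(\<lambda>x. x j) \<in> S \<rightarrow>\<^sub>M count_space UNIV" for j
  proof -
    obtain k n c c' d where n: "n \<in> {0..<\<bar>r\<bar>}" and c': "[c' * c = 1] (mod p^2)"
      and it: "\<And>x. x \<in> space ?M \<Longrightarrow>
        iterate ?M ?T k x n = (c * x j + p * (\<Sum>i=1..W. d i * x (j - i))) mod p^2"
      using rep[of j] by blast
    \<comment> \<open>The perturbation modulo p^2, written through quantities that
      \<open>p_coord\<close> has already shown measurable. Subtracting it and multiplying by
      \<open>c'\<close> recovers \<open>x j\<close>.\<close>
    let ?q = "\<lambda>x. \<Sum>i=1..W. d i * ((p * x (j - i)) mod p^2)"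
    have "x j = (c' * (iterate ?M ?T k x n - ?q x)) mod p^2" if "x \<in> space S" for x
    proof -
      let ?s = "\<Sum>i=1..W. d i * (p * x (j - i))"
      have "[c' * (iterate ?M ?T k x n - ?q x) = c' * ((c * x j + ?s) - ?s)] (mod p^2)"
      proof (intro cong_mult cong_diff cong_sum cong_refl)
        have "p * (\<Sum>i=1..W. d i * x (j - i)) = ?s"
          by (simp add: sum_distrib_left mult_ac)
        then show "[iterate ?M ?T k x n = c * x j + ?s] (mod p^2)"
          using that by (simp add: it space_S cong_def)
      qed (simp add: cong_def)
      also have "c' * ((c * x j + ?s) - ?s) = (c' * c) * x j"
        by simp
      also have "[\<dots> = 1 * x j] (mod p^2)"
        by (intro cong_mult cong_refl c')
      finally show ?thesis
        using that by (auto simp: cong_def space_S space_uniform_bernoulli)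
    qed
    moreover have "(\<lambda>x. (c' * (iterate ?M ?T k x n - ?q x)) mod p^2) \<in> S \<rightarrow>\<^sub>M count_space UNIV"
    proof -
      have "(\<lambda>x. d i * ((p * x (j - i)) mod p^2)) \<in> S \<rightarrow>\<^sub>M count_space UNIV" for i
        using measurable_compose[OF p_coord, of "\<lambda>v. d i * v" "count_space UNIV"] by simp
      then have "(\<lambda>x. iterate ?M ?T k x n - ?q x) \<in> S \<rightarrow>\<^sub>M count_space UNIV"
        by (intro measurable_int_diff measurable_int_sum iter n)
      from measurable_compose[OF this, of "\<lambda>v. (c' * v) mod p^2" "count_space UNIV"]
      show ?thesis
        by simp
    qed
    ultimately show ?thesis
      by (subst measurable_cong) auto
  qed
  have id: "(\<lambda>x. x) \<in> S \<rightarrow>\<^sub>M ?M"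
  proof (rule measurable_uniform_bernoulliI)
    fix j v
    show "{x \<in> space S. x j = v} \<in> sets S"
      using measurable_sets[OF coord, of "{v}" j] by (simp add: vimage_def Int_def conj_commute)
  qed (simp add: space_S)
  have "A \<in> sigma_sets (space ?M) \<G>" if "A \<in> sets ?M" for A
    using measurable_sets[OF id that] sets.sets_into_space[OF that]
    by (simp add: sets_S space_S Int_absorb2)
  moreover have "sym_diff A A \<in> null_sets ?M" for A
    by simp
  ultimately show ?thesis
    unfolding generator_def \<G>_def by (intro ballI bexI)
qed

lemma bernoulli_automorphism_near_shift:
  assumes "p > 0" and "W \<ge> 0" and "[a' * a = 1] (mod p^2)" and "r \<noteq> 0"
  shows "bernoulli_automorphism (uniform_bernoulli (p^2)) (near_shift p W a b r)"
  unfolding bernoulli_automorphism_def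
proof (intro conjI exI)
  show "prob_space (uniform_bernoulli (p^2))"
    using assms(1) by (intro prob_space_uniform_bernoulli) simp
qed (rule automorphism_near_shift[OF assms(1-3)] measurable_partition_window_partition
    generator_near_shift[OF assms] weakly_bernoulli_near_shift[OF assms])+

section \<open>From local rules to perturbed shifts\<close>

lemma cellular_automaton_near_shift:
  assumes "f = (\<lambda>x. (p * (\<Sum>i=s-W..s-1. b (s - i) * x i) + a * x s) mod p^2)"
  shows "cellular_automaton f = near_shift p W a b s"
proof (intro ext)
  fix x n
  have "(\<Sum>i=s-W..s-1. b (s - i) * x (n + i)) = (\<Sum>i=1..W. b i * x (n + s - i))"
    by (rule sum.reindex_bij_witness[of _ "\<lambda>i. s - i" "\<lambda>i. s - i"]) (auto simp: algebra_simps)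
  then show "cellular_automaton f x n = near_shift p W a b s x n"
    by (simp add: cellular_automaton_def assms near_shift_def add.commute)
qed

text \<open>The case \<open>r = 0\<close> is excluded because it contains the identity map
  (\<open>lam = 1\<close>, all \<open>\<beta> i = 0\<close>), which is not Bernoulli: a partition
  independent of itself has only cells of measure 0 or 1 and cannot generate.\<close>

theorem theorem5p4:
  fixes p l r lam :: int and \<beta> :: "int \<Rightarrow> int" and f :: "(int \<Rightarrow> int) \<Rightarrow> int"
  assumes "prime p" and "l \<le> r" and "r \<noteq> 0"
    and "\<forall>i\<in>{l..r-1}. \<beta> i \<in> {0..<p^2}"
    and "lam \<in> {0..<p^2}" and "gcd p lam = 1"
    and "f = (\<lambda>x. (p * (\<Sum>i=l..r-1. \<beta> i * x i) + lam * x r) mod p^2)"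
  shows "(\<exists>\<gamma> lam' g.
           (\<forall>i\<in>{-(2*r-l)..-r}. \<gamma> i \<in> {0..<p^2}) \<and>
           lam' \<in> {0..<p^2} \<and> [lam' * lam = 1] (mod p) \<and>
           g = (\<lambda>x. (- p * (\<Sum>i=-(2*r-l)..-r. \<gamma> i * x i) + lam' * x (-r)) mod p^2) \<and>
           (\<forall>x\<in>space (uniform_bernoulli (p^2)).
              cellular_automaton g (cellular_automaton f x) = x \<and>
              cellular_automaton f (cellular_automaton g x) = x))
         \<and> bernoulli_automorphism (uniform_bernoulli (p^2)) (cellular_automaton f)"
proof -
  have p: "p > 0"
    using \<open>prime p\<close> by (rule prime_gt_0_int)
  define W where "W = r - l"
  define b where "b i = \<beta> (r - i)" for i
  have W: "W \<ge> 0"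
    using assms(2) by (simp add: W_def)
  have "coprime lam p"
    using assms(6) by (simp add: coprime_iff_gcd_eq_1 gcd.commute)
  then obtain u where u: "[u * lam = 1] (mod p^2)"
    by (rule ex_inverse_mod_square)
  define lam' where "lam' = u mod p^2"
  have inv: "[lam' * lam = 1] (mod p^2)"
    using u by (simp add: lam'_def cong_def mod_mult_left_eq)
  have "[lam' * lam = 1] (mod p)"
    using inv by (rule cong_dvd_modulus) (simp add: power2_eq_square)
  moreover have "lam' \<in> {0..<p^2}"
    using p by (simp add: lam'_def)
  moreover
  \<comment> \<open>The sum in \<open>g\<close> includes the leading position \<open>- r\<close>,
    which the perturbation of a perturbed shift omits. Since \<open>lam'\<close> inverts
    \<open>lam\<close> modulo p^2 and not merely modulo p, the coefficient there can be 0; the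
    others come from \<open>near_shift_inverse\<close>, with the minus sign moved into
    \<open>- p\<close>.\<close>
  define \<gamma> where "\<gamma> i = (if i = - r then 0 else (lam'^2 * b (- r - i)) mod p^2)" for i
  have "\<forall>i\<in>{-(2*r-l)..-r}. \<gamma> i \<in> {0..<p^2}"
    using p by (simp add: \<gamma>_def)
  moreover
  have f: "cellular_automaton f = near_shift p W lam b r"
    by (rule cellular_automaton_near_shift) (simp add: assms(7) W_def b_def)
  define g where
    "g = (\<lambda>x. (- p * (\<Sum>i=-(2*r-l)..-r. \<gamma> i * x i) + lam' * x (-r)) mod p^2)"
  have "cellular_automaton g = near_shift p W lam' (\<lambda>i. - (lam'^2 * b i)) (- r)"
  proof (rule cellular_automaton_near_shift, unfold g_def, rule ext)
    fix x :: "int \<Rightarrow> int"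
    have "(\<Sum>i=-(2*r-l)..-r. \<gamma> i * x i) = (\<Sum>i=- r - W..- r - 1. \<gamma> i * x i)"
      by (rule sum.mono_neutral_right) (auto simp: W_def \<gamma>_def)
    then have "- p * (\<Sum>i=-(2*r-l)..-r. \<gamma> i * x i) =
        p * (\<Sum>i=- r - W..- r - 1. - \<gamma> i * x i)"
      by (simp add: sum_negf)
    also have "[\<dots> = p * (\<Sum>i=- r - W..- r - 1. - (lam'^2 * b (- r - i)) * x i)] (mod p^2)"
    proof (intro cong_mult cong_sum cong_refl)
      fix i assume "i \<in> {- r - W..- r - 1}"
      then show "[- \<gamma> i = - (lam'^2 * b (- r - i))] (mod p^2)"
        by (simp add: \<gamma>_def cong_def mod_minus_eq)
    qed
    finally show "(- p * (\<Sum>i=-(2*r-l)..-r. \<gamma> i * x i) + lam' * x (-r)) mod p^2 =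
        (p * (\<Sum>i=- r - W..- r - 1. - (lam'^2 * b (- r - i)) * x i) + lam' * x (-r)) mod p^2"
      unfolding cong_def[symmetric] by (intro cong_add cong_refl)
  qed
  then have "\<forall>x\<in>space (uniform_bernoulli (p^2)).
      cellular_automaton g (cellular_automaton f x) = x \<and>
      cellular_automaton f (cellular_automaton g x) = x"
    using near_shift_inverse[OF inv] by (simp add: f)
  moreover have "bernoulli_automorphism (uniform_bernoulli (p^2)) (cellular_automaton f)"
    unfolding f using p W inv assms(3) by (rule bernoulli_automorphism_near_shift)
  ultimately show ?thesis
    unfolding g_def by blast
qed

end
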